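(* Let $q$ be a prime power and let $\mathbb{F}_q$ be the finite field with $q$ elements. Let $1 \le k < n$ be integers and write $n=hk+r$ with $0 \le r \le k-1$. Assume $h \ge 2$. Let $p,p' \in \mathbb{F}_q[x]$ be irreducible monic polynomials of degree $k$ and $k+r$ respectively, and let $P:=\mathbf{M}(p)$, $P':=\mathbf{M}(p')$ be their companion matrices. For $1 \le i \le h-1$ set $$\mathcal{M}_i(p,p'):= \left\{ \begin{bmatrix} 0_k & \cdots & 0_k & I_k & A_{i+1} & \cdots & A_{h-1} & A_{(k)} \end{bmatrix} \ : \ A_{i+1},\dots, A_{h-1} \in \mathbb{F}_q[P], \ A \in \mathbb{F}_q[P'] \right\},$$ where $I_k$ is the $i$-th $k\times k$ block and $A_{(k)}$ denotes the $k \times (k+r)$ matrix formed by the last $k$ rows of $A$. Then the set $$\mathcal{C}:= \bigcup_{i=1}^{h-1}\left\{ \mathrm{rowsp} (M) : M \in \mathcal{M}_i(p,p') \right\} \cup \left\{ \mathrm{rowsp} \begin{bmatrix} 0_k & \cdots & 0_k & 0_{k \times r} & I_k \end{bmatrix} \right\}$$ (with $h-1$ blocks $0_k$ in the last matrix) is a partial spread code in $\mathbb{F}_q^n$ of dimension $k$. In particular, the minimum distance of $\mathcal{C}$ is $2k$.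
   Context: $\mathcal{G}_q(k,n)$ denotes the set of $k$-dimensional subspaces of $\mathbb{F}_q^n$. The subspace distance is $d(U,V):=\dim U+\dim V-2\dim(U\cap V)$ for subspaces $U,V\subseteq \mathbb{F}_q^n$, and the minimum distance of a set of subspaces with at least two elements is the minimum of $d(U,V)$ over distinct members $U,V$. A partial $k$-spread of $\mathbb{F}_q^n$ is a subset $\mathcal{C}\subseteq \mathcal{G}_q(k,n)$ such that $U\cap V=\{0\}$ for all distinct $U,V\in\mathcal{C}$; a partial $k$-spread with at least two elements is called a partial spread code (of dimension $k$). For a monic polynomial $f=\sum_{i=0}^m f_i x^i$ of degree $m\ge 1$, the companion matrix $\mathbf{M}(f)$ is the $m\times m$ matrix with entries $1$ on the superdiagonal, last row $(-f_0,-f_1,\dots,-f_{m-1})$, and all other entries $0$ (for $m=1$ it is the $1\times 1$ matrix $[-f_0]$). For a square matrix $Q$, $\mathbb{F}_q[Q]$ is the $\mathbb{F}_q$-algebra of matrices generated by $Q$ (and the identity). $0_k$ and $0_{k\times r}$ are zero matrices of size $k\times k$ and $k\times r$, $I_k$ is the $k\times k$ identity, and $\mathrm{rowsp}(M)$ is the row space of $M$ over $\mathbb{F}_q$. *)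

theory Defs
  imports "Jordan_Normal_Form.DL_Rank"
begin

definition subspace_of :: "nat \<Rightarrow> 'a::field vec set \<Rightarrow> bool" where
  "subspace_of n U \<longleftrightarrow> VectorSpace.subspace class_ring U (module_vec TYPE('a) n)"

definition sdim :: "nat \<Rightarrow> 'a::field vec set \<Rightarrow> nat" where
  "sdim n U = vectorspace.dim class_ring (module_vec TYPE('a) n\<lparr>carrier := U\<rparr>)"

definition grassmannian :: "nat \<Rightarrow> nat \<Rightarrow> 'a::field vec set set" where
  "grassmannian k n = {U. subspace_of n U \<and> sdim n U = k}"

definition subspace_dist :: "nat \<Rightarrow> 'a::field vec set \<Rightarrow> 'a vec set \<Rightarrow> int" where
  "subspace_dist n U V = int (sdim n U) + int (sdim n V) - 2 * int (sdim n (U \<inter> V))"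

text \<open>Only meaningful for a finite \<open>C\<close> with at least two elements; every set of subspaces of
  \<open>F\<^sup>n\<close> with \<open>F\<close> a finite field is finite.\<close>

definition min_dist :: "nat \<Rightarrow> 'a::field vec set set \<Rightarrow> int" where
  "min_dist n C = Min {subspace_dist n U V | U V. U \<in> C \<and> V \<in> C \<and> U \<noteq> V}"

definition partial_spread :: "nat \<Rightarrow> nat \<Rightarrow> 'a::field vec set set \<Rightarrow> bool" where
  "partial_spread k n C \<longleftrightarrow>
     C \<subseteq> grassmannian k n \<and> (\<forall>U\<in>C. \<forall>V\<in>C. U \<noteq> V \<longrightarrow> U \<inter> V = {0\<^sub>v n})"

definition partial_spread_code :: "nat \<Rightarrow> nat \<Rightarrow> 'a::field vec set set \<Rightarrow> bool" where
  "partial_spread_code k n C \<longleftrightarrow>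
     partial_spread k n C \<and> (\<exists>U\<in>C. \<exists>V\<in>C. U \<noteq> V)"

definition rowsp :: "nat \<Rightarrow> 'a::field mat \<Rightarrow> 'a vec set" where
  "rowsp n M = vec_space.row_space n M"

definition companion_mat :: "'a::field poly \<Rightarrow> 'a mat" where
  "companion_mat f = mat (degree f) (degree f)
     (\<lambda>(i, j). if i = degree f - 1 then - coeff f j else if j = i + 1 then 1 else 0)"

text \<open>The unital subalgebra generated by a square matrix \<open>Q\<close>, with scalars from the whole base
  field.\<close>

inductive_set gen_algebra :: "'a::field mat \<Rightarrow> 'a mat set" for Q :: "'a mat" where
  one: "1\<^sub>m (dim_row Q) \<in> gen_algebra Q"
| gen: "Q \<in> gen_algebra Q"
| add: "A \<in> gen_algebra Q \<Longrightarrow> B \<in> gen_algebra Q \<Longrightarrow> A + B \<in> gen_algebra Q"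
| mult: "A \<in> gen_algebra Q \<Longrightarrow> B \<in> gen_algebra Q \<Longrightarrow> A * B \<in> gen_algebra Q"
| smult: "A \<in> gen_algebra Q \<Longrightarrow> c \<cdot>\<^sub>m A \<in> gen_algebra Q"

definition last_rows :: "nat \<Rightarrow> 'a mat \<Rightarrow> 'a mat" where
  "last_rows k A = mat k (dim_col A) (\<lambda>(i, j). A $$ (dim_row A - k + i, j))"

definition append_cols :: "'a::zero mat \<Rightarrow> 'a mat \<Rightarrow> 'a mat" where
  "append_cols A B = four_block_mat A B (0\<^sub>m 0 (dim_col A)) (0\<^sub>m 0 (dim_col B))"

text \<open>\<open>block_row k [B\<^sub>1, ..., B\<^sub>m]\<close> is \<open>[B\<^sub>1 ... B\<^sub>m]\<close>, for blocks with \<open>k\<close> rows each.\<close>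

definition block_row :: "nat \<Rightarrow> 'a::zero mat list \<Rightarrow> 'a mat" where
  "block_row k Bs = foldr append_cols Bs (0\<^sub>m k 0)"

text \<open>The index \<open>i\<close> is 1-based, as is the family \<open>A\<close>, of which only \<open>A (i+1), ..., A (h-1)\<close> are
  used.\<close>

definition code_matrices ::
  "nat \<Rightarrow> nat \<Rightarrow> nat \<Rightarrow> 'a::field poly \<Rightarrow> 'a poly \<Rightarrow> 'a mat set" where
  "code_matrices h k i p p' =
     {block_row k (replicate (i - 1) (0\<^sub>m k k) @ [1\<^sub>m k] @ map A [i + 1..<h] @ [last_rows k A']) | A A'.
        (\<forall>j\<in>{i + 1..h - 1}. A j \<in> gen_algebra (companion_mat p)) \<and>
        A' \<in> gen_algebra (companion_mat p')}"

definition spread_code ::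
  "nat \<Rightarrow> nat \<Rightarrow> nat \<Rightarrow> nat \<Rightarrow> 'a::field poly \<Rightarrow> 'a poly \<Rightarrow> 'a vec set set" where
  "spread_code n h k r p p' =
     (\<Union>i\<in>{1..h - 1}. {rowsp n M | M. M \<in> code_matrices h k i p p'}) \<union>
     {rowsp n (block_row k (replicate (h - 1) (0\<^sub>m k k) @ [0\<^sub>m k r, 1\<^sub>m k]))}"

end

theory Submission
  imports Defs "HOL-Computational_Algebra.Polynomial_Factorial"
begin

text \<open>Let two codewords share a nonzero vector \<open>v = x M = y N\<close>. The first nonzero block of \<open>v\<close>
  is the pivot block of both matrices, so the pivots agree and \<open>x = y \<noteq> 0\<close>. In every later block
  two members of one companion algebra agree on the row \<open>x\<close> (in the last block, on \<open>(0, x)\<close>).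
  Such an algebra is the field \<open>F[X]/(p)\<close> acting on itself by multiplication, so they coincide
  and \<open>M = N\<close>.\<close>

section \<open>Row vectors as polynomials, and the action of a companion algebra on them\<close>

definition vec_poly :: "'a::zero vec \<Rightarrow> 'a poly" where
  "vec_poly x = Poly (list_of_vec x)"

lemma coeff_vec_poly: "coeff (vec_poly x) i = (if i < dim_vec x then x $ i else 0)"
  by (simp add: vec_poly_def nth_default_def list_of_vec_index)

text \<open>\<open>Poly\<close> drops trailing zeros, so the polynomial forgets the length of the
  vector; the dimension hypothesis restores it.\<close>

lemma vec_poly_inject:
  fixes x y :: "'a::zero vec"
  assumes "vec_poly x = vec_poly y" "dim_vec x = dim_vec y"
  shows "x = y"
  by (rule eq_vecI) (use assms coeff_vec_poly in metis)+

lemma companion_mat_carrier: "companion_mat p \<in> carrier_mat (degree p) (degree p)"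
  by (simp add: companion_mat_def)

lemma gen_algebra_carrier:
  assumes "A \<in> gen_algebra Q" "Q \<in> carrier_mat m m"
  shows "A \<in> carrier_mat m m"
  using assms by (induction) auto

text \<open>Row vectors are modelled by transposes: \<open>x\<close> times the matrix is its
  transpose applied to \<open>x\<close>. Multiplication by X shifts the entries up by one; the
  overflow \<open>x $ (m - 1)\<close> at X^m is reduced by subtracting that multiple of the monic
  \<open>p\<close>, whose lower coefficients, negated, form the last row of the companion
  matrix.\<close>

lemma vec_poly_companion_mat:
  fixes p :: "'a::field poly"
  assumes p: "lead_coeff p = 1" "degree p = m" "m \<ge> 1" and x: "x \<in> carrier_vec m"
  shows "vec_poly ((companion_mat p)\<^sup>T *\<^sub>v x) = [:0, 1:] * vec_poly x - Polynomial.smult (x $ (m - 1)) p"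
proof (rule poly_eqI)
  fix j
  have col: "((companion_mat p)\<^sup>T *\<^sub>v x) $ j
      = - (coeff p j * x $ (m - 1)) + (if j = 0 then 0 else x $ (j - 1))" if j: "j < m"
  proof -
    have "((companion_mat p)\<^sup>T *\<^sub>v x) $ j = (\<Sum>i\<in>{0..<m}. companion_mat p $$ (i, j) * x $ i)"
      using j x p companion_mat_carrier[of p] by (auto simp: scalar_prod_def)
    \<comment> \<open>Column \<open>j\<close> has possible nonzero entries only in the last row and,
      on the superdiagonal, in row \<open>j - 1\<close>. For \<open>j = 0\<close> natural
      subtraction gives \<open>j - 1 = 0\<close>, so the inner conditional suppresses a spurious
      second term.\<close>
    also have "\<dots> = (\<Sum>i\<in>{0..<m}. (if i = m - 1 then - coeff p j * x $ (m - 1) else 0)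
        + (if i = j - 1 then (if j = 0 then 0 else x $ (j - 1)) else 0))"
      using j p by (intro sum.cong) (auto simp: companion_mat_def)
    also have "\<dots> = - (coeff p j * x $ (m - 1)) + (if j = 0 then 0 else x $ (j - 1))"
      using j p by (auto simp: sum.distrib)
    finally show ?thesis .
  qed
  have dim: "dim_vec ((companion_mat p)\<^sup>T *\<^sub>v x) = m"
    using p companion_mat_carrier[of p] by simp
  have pm: "coeff p m = 1" "\<And>j. j > m \<Longrightarrow> coeff p j = 0"
    using p by (auto simp: coeff_eq_0)
  \<comment> \<open>At \<open>j = m\<close> the shifted entry \<open>x $ (m - 1)\<close> cancels
    against the leading coefficient of \<open>p\<close>; above \<open>m\<close> every term
    vanishes.\<close>
  show "coeff (vec_poly ((companion_mat p)\<^sup>T *\<^sub>v x)) j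
      = coeff ([:0, 1:] * vec_poly x - Polynomial.smult (x $ (m - 1)) p) j"
    using col pm x p(3) unfolding coeff_vec_poly dim
    by (cases j; cases "j < m"; cases "j = m") (auto simp: coeff_pCons coeff_vec_poly)
qed

text \<open>Identifying a row vector with a polynomial of degree below \<open>degree p\<close>, the companion matrix
  acts from the right as multiplication by \<open>X\<close> modulo \<open>p\<close>.\<close>

lemma gen_algebra_companion_mat_action:
  fixes p :: "'a::field poly"
  assumes p: "lead_coeff p = 1" "degree p = m" "m \<ge> 1" and A: "A \<in> gen_algebra (companion_mat p)"
  shows "\<exists>f. \<forall>x\<in>carrier_vec m. p dvd f * vec_poly x - vec_poly (A\<^sup>T *\<^sub>v x)"
proof -
  let ?P = "companion_mat p"
  have P: "?P \<in> carrier_mat m m"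
    using companion_mat_carrier p by blast
  have c: "B \<in> gen_algebra ?P \<Longrightarrow> B \<in> carrier_mat m m" for B
    using gen_algebra_carrier[OF _ P] .
  show ?thesis using A
  proof induction
    case one
    show ?case using P by (intro exI[of _ 1]) auto
  next
    case gen
    \<comment> \<open>With X as the multiplier, the remaining difference is
      \<open>x $ (m - 1)\<close> times \<open>p\<close>.\<close>
    show ?case
      by (intro exI[of _ "[:0, 1:]"]) (use vec_poly_companion_mat[OF p] in \<open>auto simp: dvd_smult\<close>)
  next
    case (add A B)
    obtain f where f: "\<And>x. x \<in> carrier_vec m \<Longrightarrow> p dvd f * vec_poly x - vec_poly (A\<^sup>T *\<^sub>v x)"
      using add.IH(1) by blast
    obtain g where g: "\<And>x. x \<in> carrier_vec m \<Longrightarrow> p dvd g * vec_poly x - vec_poly (B\<^sup>T *\<^sub>v x)"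
      using add.IH(2) by blast
    have "p dvd (f + g) * vec_poly x - vec_poly ((A + B)\<^sup>T *\<^sub>v x)" if x: "x \<in> carrier_vec m" for x
    proof -
      have "(A + B)\<^sup>T *\<^sub>v x = A\<^sup>T *\<^sub>v x + B\<^sup>T *\<^sub>v x"
        using c[OF add.hyps(1)] c[OF add.hyps(2)] x
        by (simp add: transpose_add[of A m m] add_mult_distrib_mat_vec[of _ m m])
      then have "vec_poly ((A + B)\<^sup>T *\<^sub>v x) = vec_poly (A\<^sup>T *\<^sub>v x) + vec_poly (B\<^sup>T *\<^sub>v x)"
        using c[OF add.hyps(1)] c[OF add.hyps(2)]
        by (auto intro!: poly_eqI simp: coeff_vec_poly)
      then have "(f + g) * vec_poly x - vec_poly ((A + B)\<^sup>T *\<^sub>v x)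
        = (f * vec_poly x - vec_poly (A\<^sup>T *\<^sub>v x)) + (g * vec_poly x - vec_poly (B\<^sup>T *\<^sub>v x))"
        by (simp add: algebra_simps)
      then show ?thesis using f[OF x] g[OF x] by (simp add: dvd_add)
    qed
    then show ?case by blast
  next
    case (mult A B)
    obtain f where f: "\<And>x. x \<in> carrier_vec m \<Longrightarrow> p dvd f * vec_poly x - vec_poly (A\<^sup>T *\<^sub>v x)"
      using mult.IH(1) by blast
    obtain g where g: "\<And>x. x \<in> carrier_vec m \<Longrightarrow> p dvd g * vec_poly x - vec_poly (B\<^sup>T *\<^sub>v x)"
      using mult.IH(2) by blast
    have "p dvd (g * f) * vec_poly x - vec_poly ((A * B)\<^sup>T *\<^sub>v x)" if x: "x \<in> carrier_vec m" for x
    proof -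
      have Ax: "A\<^sup>T *\<^sub>v x \<in> carrier_vec m"
        using c[OF mult.hyps(1)] by (auto intro: carrier_vecI)
      have "(A * B)\<^sup>T *\<^sub>v x = B\<^sup>T *\<^sub>v (A\<^sup>T *\<^sub>v x)"
        using c[OF mult.hyps(1)] c[OF mult.hyps(2)] x
        by (simp add: transpose_mult[of A m m B m] assoc_mult_mat_vec[of _ m m _ m])
      \<comment> \<open>A row vector meets \<open>A\<close> before \<open>B\<close>. The error of
        the product is \<open>g\<close> times the error of \<open>A\<close> at \<open>x\<close>,
        plus the error of \<open>B\<close> at the image of \<open>x\<close> under
        \<open>A\<close>.\<close>
      then have "(g * f) * vec_poly x - vec_poly ((A * B)\<^sup>T *\<^sub>v x)
        = g * (f * vec_poly x - vec_poly (A\<^sup>T *\<^sub>v x))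
          + (g * vec_poly (A\<^sup>T *\<^sub>v x) - vec_poly (B\<^sup>T *\<^sub>v (A\<^sup>T *\<^sub>v x)))"
        by (simp add: algebra_simps)
      then show ?thesis using f[OF x] g[OF Ax] by (simp add: dvd_add)
    qed
    then show ?case by blast
  next
    case (smult A a)
    obtain f where f: "\<And>x. x \<in> carrier_vec m \<Longrightarrow> p dvd f * vec_poly x - vec_poly (A\<^sup>T *\<^sub>v x)"
      using smult.IH by blast
    have "p dvd Polynomial.smult a f * vec_poly x - vec_poly ((a \<cdot>\<^sub>m A)\<^sup>T *\<^sub>v x)"
      if x: "x \<in> carrier_vec m" for x
    proof -
      have "vec_poly ((a \<cdot>\<^sub>m A)\<^sup>T *\<^sub>v x) = Polynomial.smult a (vec_poly (A\<^sup>T *\<^sub>v x))"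
        using c[OF smult.hyps] x
        by (intro poly_eqI) (auto simp: coeff_vec_poly scalar_prod_def sum_distrib_left mult_ac)
      then have "Polynomial.smult a f * vec_poly x - vec_poly ((a \<cdot>\<^sub>m A)\<^sup>T *\<^sub>v x)
        = Polynomial.smult a (f * vec_poly x - vec_poly (A\<^sup>T *\<^sub>v x))"
        by (simp add: smult_diff_right)
      then show ?thesis using f[OF x] by (simp add: dvd_smult)
    qed
    then show ?case by blast
  qed
qed

lemma eq_mat_by_transpose_action:
  fixes A B :: "'a::semiring_1 mat"
  assumes "A \<in> carrier_mat m n" "B \<in> carrier_mat m n"
    and "\<And>y. y \<in> carrier_vec m \<Longrightarrow> A\<^sup>T *\<^sub>v y = B\<^sup>T *\<^sub>v y"
  shows "A = B"
proof (rule eq_matI)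
  fix i j assume "i < dim_row B" "j < dim_col B"
  then show "A $$ (i, j) = B $$ (i, j)"
    using assms(1,2) arg_cong[OF assms(3)[of "unit_vec m i"], of "\<lambda>v. v $ j"] by auto
qed (use assms in auto)

text \<open>Let \<open>A\<close> and \<open>B\<close> act as multiplication by f and g modulo
  \<open>p\<close>. Agreement at one nonzero \<open>x\<close> makes \<open>p\<close> divide (f - g)
  times the polynomial of \<open>x\<close>, hence f - g, and then the two actions agree
  everywhere.\<close>

lemma gen_algebra_companion_mat_inject:
  fixes p :: "'a::field poly"
  assumes p: "irreducible p" "lead_coeff p = 1" "degree p = m" "m \<ge> 1"
    and A: "A \<in> gen_algebra (companion_mat p)" and B: "B \<in> gen_algebra (companion_mat p)"
    and x: "x \<in> carrier_vec m" "x \<noteq> 0\<^sub>v m" and eq: "A\<^sup>T *\<^sub>v x = B\<^sup>T *\<^sub>v x"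
  shows "A = B"
proof -
  have P: "companion_mat p \<in> carrier_mat m m"
    using companion_mat_carrier p by blast
  note cA = gen_algebra_carrier[OF A P] and cB = gen_algebra_carrier[OF B P]
  obtain f g where
    f: "\<And>x. x \<in> carrier_vec m \<Longrightarrow> p dvd f * vec_poly x - vec_poly (A\<^sup>T *\<^sub>v x)" and
    g: "\<And>x. x \<in> carrier_vec m \<Longrightarrow> p dvd g * vec_poly x - vec_poly (B\<^sup>T *\<^sub>v x)"
    using gen_algebra_companion_mat_action[OF p(2-4) A] gen_algebra_companion_mat_action[OF p(2-4) B]
    by blast
  \<comment> \<open>A multiple of \<open>p\<close> of degree below \<open>m\<close> is zero; this
    turns congruences modulo \<open>p\<close> into equalities of vectors.\<close>
  have small: "q = 0" if "p dvd q" "\<And>i. i \<ge> m \<Longrightarrow> coeff q i = 0" for q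
  proof (rule ccontr)
    assume "q \<noteq> 0"
    then have "degree q < m" using that(2)[of "degree q"] by (metis leading_coeff_0_iff not_le)
    then show False using dvd_imp_degree_le[OF that(1) \<open>q \<noteq> 0\<close>] p by simp
  qed
  have "p dvd (f - g) * vec_poly x"
    using dvd_diff[OF f[OF x(1)] g[OF x(1)]] eq by (simp add: algebra_simps)
  moreover have "\<not> p dvd vec_poly x"
  proof
    assume "p dvd vec_poly x"
    then have "vec_poly x = 0" using x by (intro small) (auto simp: coeff_vec_poly)
    then have "vec_poly x = vec_poly (0\<^sub>v m)"
      by (auto intro!: poly_eqI simp: coeff_vec_poly)
    then show False using vec_poly_inject x by fastforce
  qed
  \<comment> \<open>Over a field an irreducible polynomial is prime, so \<open>p\<close> divides one
    of the two factors.\<close>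
  ultimately have fg: "p dvd f - g"
    using p(1) prime_elem_dvd_mult_iff[of p] field_poly_irreducible_imp_prime by blast
  show ?thesis
  proof (rule eq_mat_by_transpose_action[OF cA cB])
    fix y :: "'a vec" assume y: "y \<in> carrier_vec m"
    \<comment> \<open>The terms with \<open>f\<close> and \<open>g\<close> cancel, leaving the
      difference of the two images of \<open>y\<close>.\<close>
    have "p dvd (f - g) * vec_poly y - (f * vec_poly y - vec_poly (A\<^sup>T *\<^sub>v y))
        + (g * vec_poly y - vec_poly (B\<^sup>T *\<^sub>v y))"
      by (rule dvd_add[OF dvd_diff[OF dvd_mult2[OF fg] f[OF y]] g[OF y]])
    then have "p dvd vec_poly (A\<^sup>T *\<^sub>v y) - vec_poly (B\<^sup>T *\<^sub>v y)"
      by (simp add: algebra_simps)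
    then have "vec_poly (A\<^sup>T *\<^sub>v y) - vec_poly (B\<^sup>T *\<^sub>v y) = 0"
      using cA cB by (intro small) (auto simp: coeff_vec_poly)
    then show "A\<^sup>T *\<^sub>v y = B\<^sup>T *\<^sub>v y"
      using cA cB by (intro vec_poly_inject) auto
  qed
qed

section \<open>Block rows applied to coefficient vectors\<close>

lemma transpose_append_cols_mult_vec:
  fixes A B :: "'a::semiring_0 mat"
  assumes "dim_row A = k" "dim_row B = k" "x \<in> carrier_vec k"
  shows "(append_cols A B)\<^sup>T *\<^sub>v x = (A\<^sup>T *\<^sub>v x) @\<^sub>v (B\<^sup>T *\<^sub>v x)"
  using assms by (intro eq_vecI) (auto simp: append_cols_def scalar_prod_def)

lemma append_cols_carrier:
  assumes "dim_row A = k" "dim_row B = k"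
  shows "append_cols A B \<in> carrier_mat k (dim_col A + dim_col B)"
  using assms by (auto simp: append_cols_def)

lemma block_row_Cons: "block_row k (B # Bs) = append_cols B (block_row k Bs)"
  by (simp add: block_row_def)

lemma block_row_carrier:
  assumes "\<And>B. B \<in> set Bs \<Longrightarrow> dim_row B = k"
  shows "block_row k Bs \<in> carrier_mat k (\<Sum>B\<leftarrow>Bs. dim_col B)"
  using assms
proof (induction Bs)
  case Nil
  then show ?case by (simp add: block_row_def)
next
  case (Cons B Bs)
  then have "block_row k Bs \<in> carrier_mat k (\<Sum>B\<leftarrow>Bs. dim_col B)" by auto
  then show ?case
    using append_cols_carrier[of B k "block_row k Bs"] Cons.prems by (auto simp: block_row_Cons)
qed

text \<open>Equal concatenations split at equal lengths. Only the leading blocks have to match in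
  size; the tails may be cut differently, as happens when a generator matrix is compared with that
  of the final codeword.\<close>

lemma block_row_eq_prefixD:
  fixes Bs :: "'a::semiring_0 mat list"
  assumes "list_all2 (\<lambda>B C. dim_row B = k \<and> dim_row C = k \<and> dim_col B = dim_col C) Bs Cs"
    and "\<And>B. B \<in> set Bs' \<Longrightarrow> dim_row B = k" "\<And>C. C \<in> set Cs' \<Longrightarrow> dim_row C = k"
    and "x \<in> carrier_vec k" "y \<in> carrier_vec k"
    and "(block_row k (Bs @ Bs'))\<^sup>T *\<^sub>v x = (block_row k (Cs @ Cs'))\<^sup>T *\<^sub>v y"
  shows "list_all2 (\<lambda>B C. B\<^sup>T *\<^sub>v x = C\<^sup>T *\<^sub>v y) Bs Cs"
  using assms(1,6)
proof (induction rule: list_all2_induct)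
  case Nil
  then show ?case by simp
next
  case (Cons B Bs C Cs)
  have rows: "dim_row D = k" if "D \<in> set Bs \<union> set Cs" for D
    using Cons.hyps(2) that by (auto simp: list_all2_conv_all_nth in_set_conv_nth)
  have "dim_row (block_row k (Bs @ Bs')) = k" "dim_row (block_row k (Cs @ Cs')) = k"
    using block_row_carrier[of "Bs @ Bs'" k] block_row_carrier[of "Cs @ Cs'" k] rows assms(2,3)
    by (auto simp: Un_iff)
  then have "(B\<^sup>T *\<^sub>v x) @\<^sub>v ((block_row k (Bs @ Bs'))\<^sup>T *\<^sub>v x)
      = (C\<^sup>T *\<^sub>v y) @\<^sub>v ((block_row k (Cs @ Cs'))\<^sup>T *\<^sub>v y)"
    using Cons.hyps(1) Cons.prems assms(4,5)
    by (simp add: block_row_Cons transpose_append_cols_mult_vec)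
  moreover have "B\<^sup>T *\<^sub>v x \<in> carrier_vec (dim_col B)" "C\<^sup>T *\<^sub>v y \<in> carrier_vec (dim_col B)"
    using Cons.hyps(1) by (auto intro: carrier_vecI)
  ultimately show ?case using Cons.IH append_vec_eq by auto
qed

section \<open>Row spaces: membership, dimension and distance\<close>

lemma mem_rowsp_iff:
  assumes "M \<in> carrier_mat k n"
  shows "v \<in> rowsp n M \<longleftrightarrow> (\<exists>x\<in>carrier_vec k. v = M\<^sup>T *\<^sub>v x)"
  unfolding rowsp_def vec_space.row_space_eq[OF assms] using assms by (auto intro: carrier_vecI)

text \<open>The rows of \<open>M\<close> are the columns of its transpose; a trivial kernel makes
  them independent, so the rank is \<open>k\<close>.\<close>

lemma rowsp_in_grassmannian:
  fixes M :: "'a::field mat"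
  assumes M: "M \<in> carrier_mat k n"
    and ker: "\<And>x. x \<in> carrier_vec k \<Longrightarrow> M\<^sup>T *\<^sub>v x = 0\<^sub>v n \<Longrightarrow> x = 0\<^sub>v k"
  shows "rowsp n M \<in> grassmannian k n"
proof -
  interpret vec_space "TYPE('a)" n .
  have MT: "M\<^sup>T \<in> carrier_mat n k" using M by simp
  \<comment> \<open>Independence is stated for the set of columns, where repetitions would be lost,
    so distinctness is shown first. Equal columns \<open>i\<close> and \<open>j\<close> would put
    the difference of two unit vectors into the kernel.\<close>
  have dist: "distinct (cols M\<^sup>T)"
  proof (rule ccontr)
    assume "\<not> distinct (cols M\<^sup>T)"
    then obtain i j where ij: "i < k" "j < k" "i \<noteq> j" "col M\<^sup>T i = col M\<^sup>T j"
      using MT by (auto simp: distinct_conv_nth)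
    let ?x = "unit_vec k i - unit_vec k j :: 'a vec"
    have "M\<^sup>T *\<^sub>v ?x = M\<^sup>T *\<^sub>v unit_vec k i - M\<^sup>T *\<^sub>v unit_vec k j"
      using MT by (intro mult_minus_distrib_mat_vec) auto
    also have "\<dots> = 0\<^sub>v n"
    proof (rule eq_vecI)
      fix l assume l: "l < dim_vec (0\<^sub>v n)"
      have "M\<^sup>T $$ (l, i) = M\<^sup>T $$ (l, j)"
        using arg_cong[OF ij(4), of "\<lambda>v. v $ l"] l MT ij(1,2) by (simp del: col_transpose)
      then show "(M\<^sup>T *\<^sub>v unit_vec k i - M\<^sup>T *\<^sub>v unit_vec k j) $ l = 0\<^sub>v n $ l"
        using l M ij by auto
    qed (use MT in auto)
    finally have "?x = 0\<^sub>v k" by (intro ker) auto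
    then have "?x $ i = 0" using ij by simp
    then show False using ij by simp
  qed
  have "lin_indpt (set (cols M\<^sup>T))"
    using lin_depE[OF MT _ dist] ker by metis
  then have "rank M\<^sup>T = k" using lin_indpt_full_rank[OF MT dist] by simp
  then have "sdim n (rowsp n M) = k"
    unfolding rank_def sdim_def rowsp_def row_space_eq_col_space_transpose col_space_def .
  moreover have "subspace_of n (rowsp n M)"
    unfolding subspace_of_def rowsp_def row_space_eq_col_space_transpose col_space_def
    using cols_dim[of "M\<^sup>T"] MT by (intro span_is_subspace) (auto simp del: cols_transpose)
  ultimately show ?thesis by (simp add: grassmannian_def)
qed

lemma sdim_zero: "sdim n {0\<^sub>v n :: 'a::field vec} = 0"
proof -
  interpret vec_space "TYPE('a)" n .
  show ?thesis unfolding sdim_def using dim_zero_vs span_empty by simp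
qed

lemma zero_in_grassmannian:
  assumes "(U :: 'a::field vec set) \<in> grassmannian k n"
  shows "0\<^sub>v n \<in> U"
proof -
  interpret vec_space "TYPE('a)" n .
  show ?thesis
    using assms unfolding grassmannian_def subspace_of_def subspace_def submodule_def by auto
qed

text \<open>Members have dimension \<open>k\<close> and meet trivially, so every pair of distinct
  members is at distance \<open>2 * k\<close>. Since such a pair exists, \<open>Min\<close> is taken
  over a singleton rather than the empty set.\<close>

lemma partial_spread_code_min_dist:
  assumes "partial_spread_code k n C"
  shows "min_dist n C = 2 * int k"
proof -
  have "subspace_dist n U V = 2 * int k" if UV: "U \<in> C" "V \<in> C" "U \<noteq> V" for U V
  proof -
    have "U \<inter> V = {0\<^sub>v n}" "sdim n U = k" "sdim n V = k"
      using assms UV unfolding partial_spread_code_def partial_spread_def grassmannian_def by blast+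
    then show ?thesis by (simp add: subspace_dist_def sdim_zero)
  qed
  then have "subspace_dist n U V = d \<longleftrightarrow> d = 2 * int k"
    if "U \<in> C" "V \<in> C" "U \<noteq> V" for U V d
    using that by auto
  moreover have "\<exists>U V. U \<in> C \<and> V \<in> C \<and> U \<noteq> V"
    using assms unfolding partial_spread_code_def by blast
  ultimately have "(\<exists>U V. d = subspace_dist n U V \<and> U \<in> C \<and> V \<in> C \<and> U \<noteq> V)
      \<longleftrightarrow> d = 2 * int k" for d
    by metis
  then have "{subspace_dist n U V | U V. U \<in> C \<and> V \<in> C \<and> U \<noteq> V} = {2 * int k}"
    by auto
  then show ?thesis by (simp add: min_dist_def)
qed

text \<open>The identity block reproduces the coefficient vector inside the product, so the kernel
  is trivial.\<close>

lemma rowsp_block_row_in_grassmannian: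
  fixes Bs :: "'a::field mat list"
  assumes rows: "\<And>B. B \<in> set Bs \<Longrightarrow> dim_row B = k"
    and n: "(\<Sum>B\<leftarrow>Bs. dim_col B) = n" and one: "1\<^sub>m k \<in> set Bs"
  shows "rowsp n (block_row k Bs) \<in> grassmannian k n"
proof (rule rowsp_in_grassmannian)
  show M: "block_row k Bs \<in> carrier_mat k n"
    using block_row_carrier[of Bs k] rows n by auto
  fix x :: "'a vec" assume x: "x \<in> carrier_vec k" and ker: "(block_row k Bs)\<^sup>T *\<^sub>v x = 0\<^sub>v n"
  \<comment> \<open>A kernel vector is compared blockwise with the zero vector, using empty
    tails.\<close>
  have "(block_row k (Bs @ []))\<^sup>T *\<^sub>v x = (block_row k (Bs @ []))\<^sup>T *\<^sub>v 0\<^sub>v k"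
    using M ker by (auto intro!: eq_vecI)
  then have "list_all2 (\<lambda>B C. B\<^sup>T *\<^sub>v x = C\<^sup>T *\<^sub>v 0\<^sub>v k) Bs Bs"
    using rows x by (intro block_row_eq_prefixD[of k _ _ "[]" "[]"]) (auto simp: list_all2_same)
  then have "(1\<^sub>m k)\<^sup>T *\<^sub>v x = (1\<^sub>m k)\<^sup>T *\<^sub>v 0\<^sub>v k"
    using one by (auto simp: list_all2_same)
  then show "x = 0\<^sub>v k" using x by simp
qed

text \<open>Padding \<open>x\<close> with \<open>r\<close> leading zeros ignores the first
  \<open>r\<close> rows. This lifts an equation about the truncated block to the full matrix, on
  which the field argument works.\<close>

lemma transpose_last_rows_mult_vec:
  fixes A :: "'a::semiring_0 mat"
  assumes A: "A \<in> carrier_mat (r + k) m" and x: "x \<in> carrier_vec k"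
  shows "(last_rows k A)\<^sup>T *\<^sub>v x = A\<^sup>T *\<^sub>v (0\<^sub>v r @\<^sub>v x)"
proof (rule eq_vecI)
  fix j assume "j < dim_vec (A\<^sup>T *\<^sub>v (0\<^sub>v r @\<^sub>v x))"
  then have j: "j < m" using A by simp
  have "(A\<^sup>T *\<^sub>v (0\<^sub>v r @\<^sub>v x)) $ j
      = (\<Sum>i = 0..<r + k. A $$ (i, j) * (if i < r then 0 else x $ (i - r)))"
    using A x j by (auto simp: scalar_prod_def intro!: sum.cong)
  also have "\<dots> = (\<Sum>i = 0..<r. A $$ (i, j) * (if i < r then 0 else x $ (i - r)))
      + (\<Sum>i = r..<r + k. A $$ (i, j) * (if i < r then 0 else x $ (i - r)))"
    by (rule sum.atLeastLessThan_concat[symmetric]) auto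
  also have "\<dots> = (\<Sum>i = 0..<k. A $$ (r + i, j) * x $ i)"
    using sum.shift_bounds_nat_ivl[of "\<lambda>i. A $$ (i, j) * (if i < r then 0 else x $ (i - r))" 0 r k]
    by (simp add: add.commute)
  finally show "((last_rows k A)\<^sup>T *\<^sub>v x) $ j = (A\<^sup>T *\<^sub>v (0\<^sub>v r @\<^sub>v x)) $ j"
    using A x j by (auto simp: last_rows_def scalar_prod_def)
qed (use A in \<open>simp add: last_rows_def\<close>)

lemma zero_mat_mult_vec:
  fixes y :: "'a::semiring_0 vec"
  assumes "y \<in> carrier_vec n"
  shows "0\<^sub>m m n *\<^sub>v y = 0\<^sub>v m"
  using assms by (intro eq_vecI) auto

section \<open>The generator matrices and their block shapes\<close>

context
  fixes p p' :: "'a::field poly" and n k h r :: nat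
  assumes k: "1 \<le> k" and n: "n = h * k + r" and h: "h \<ge> 2"
    and p: "irreducible p" "lead_coeff p = 1" "degree p = k"
    and p': "irreducible p'" "lead_coeff p' = 1" "degree p' = k + r"
begin

definition blocks :: "nat \<Rightarrow> (nat \<Rightarrow> 'a mat) \<Rightarrow> 'a mat \<Rightarrow> 'a mat list" where
  "blocks i A A' = replicate (i - 1) (0\<^sub>m k k) @ [1\<^sub>m k] @ map A [i + 1..<h] @ [last_rows k A']"

abbreviation (input) admissible :: "nat \<Rightarrow> (nat \<Rightarrow> 'a mat) \<Rightarrow> 'a mat \<Rightarrow> bool" where
  "admissible i A A' \<equiv> i \<in> {1..h - 1} \<and> (\<forall>j\<in>{i + 1..h - 1}. A j \<in> gen_algebra (companion_mat p)) \<and>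
    A' \<in> gen_algebra (companion_mat p')"

text \<open>The last \<open>k + r\<close> columns are cut into two blocks here, whereas
  \<open>blocks\<close> covers them by one; the two lists agree in shape only on the first
  \<open>h - 1\<close> blocks.\<close>

definition final_blocks :: "'a mat list" where
  "final_blocks = replicate (h - 1) (0\<^sub>m k k) @ [0\<^sub>m k r, 1\<^sub>m k]"

lemma companion_algebra_carrier:
  "A \<in> gen_algebra (companion_mat p) \<Longrightarrow> A \<in> carrier_mat k k"
  "A \<in> gen_algebra (companion_mat p') \<Longrightarrow> A \<in> carrier_mat (k + r) (k + r)"
  using gen_algebra_carrier companion_mat_carrier p(3) p'(3) by metis+

lemma spread_code_cases:
  assumes "U \<in> spread_code n h k r p p'"
  obtains i A A' where "admissible i A A'" "U = rowsp n (block_row k (blocks i A A'))"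
  | "U = rowsp n (block_row k final_blocks)"
  using assms unfolding spread_code_def code_matrices_def blocks_def[symmetric] final_blocks_def[symmetric] by blast

text \<open>List positions start at 0, while the pivot index and the family \<open>A\<close> start
  at 1; hence the pivot at \<open>i - 1\<close> and the argument \<open>Suc j\<close>.\<close>

lemma nth_blocks:
  assumes "1 \<le> i" "i < h" "j < h"
  shows "blocks i A A' ! j = (if j < i - 1 then 0\<^sub>m k k else if j = i - 1 then 1\<^sub>m k
    else if j < h - 1 then A (Suc j) else last_rows k A')"
  using assms
  by (auto simp: blocks_def nth_append nth_Cons split: nat.splits intro!: arg_cong[of _ _ A])

lemma length_blocks:
  assumes "admissible i A A'"
  shows "length (blocks i A A') = h"
  using assms by (auto simp: blocks_def)

lemma dim_nth_blocks:
  assumes adm: "admissible i A A'" and j: "j < h"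
  shows "dim_row (blocks i A A' ! j) = k"
    and "dim_col (blocks i A A' ! j) = (if j < h - 1 then k else k + r)"
proof -
  have i: "1 \<le> i" "i < h" using adm by auto
  \<comment> \<open>Strictly between the pivot and the last block, \<open>Suc j\<close> lies in
    \<open>{i + 1..h - 1}\<close>, where membership in the algebra fixes the size.\<close>
  have "A (Suc j) \<in> carrier_mat k k" if "\<not> j < i - 1" "j \<noteq> i - 1" "j < h - 1"
    using adm that by (intro companion_algebra_carrier(1)) auto
  moreover have "A' \<in> carrier_mat (k + r) (k + r)"
    using adm companion_algebra_carrier(2) by blast
  ultimately show "dim_row (blocks i A A' ! j) = k"
    "dim_col (blocks i A A' ! j) = (if j < h - 1 then k else k + r)"
    unfolding nth_blocks[OF i j] using i j by (auto simp: last_rows_def)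
qed

lemma dim_row_blocks:
  assumes "admissible i A A'" "B \<in> set (blocks i A A')"
  shows "dim_row B = k"
  using assms dim_nth_blocks(1)[OF assms(1)] length_blocks[OF assms(1)]
  unfolding in_set_conv_nth by metis

lemma sum_dim_col_blocks:
  assumes adm: "admissible i A A'"
  shows "(\<Sum>B\<leftarrow>blocks i A A'. dim_col B) = n"
proof -
  have sum_nth: "(\<Sum>B\<leftarrow>Bs. dim_col B) = (\<Sum>j = 0..<length Bs. dim_col (Bs ! j))"
    for Bs :: "'a mat list"
    by (simp add: sum_list_sum_nth)
  have "(\<Sum>B\<leftarrow>blocks i A A'. dim_col B) = (\<Sum>j = 0..<h. if j < h - 1 then k else k + r)"
    unfolding sum_nth length_blocks[OF adm]
    by (intro sum.cong) (auto simp only: atLeastLessThan_iff dim_nth_blocks(2)[OF adm])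
  also have "\<dots> = n"
    using h n by (cases h) auto
  finally show ?thesis .
qed

lemma sum_dim_col_final_blocks: "(\<Sum>B\<leftarrow>final_blocks. dim_col B) = n"
  unfolding final_blocks_def using h n by (cases h) (auto simp: sum_list_replicate)

lemma blocks_carrier:
  assumes "admissible i A A'"
  shows "block_row k (blocks i A A') \<in> carrier_mat k n"
  using block_row_carrier dim_row_blocks[OF assms] sum_dim_col_blocks[OF assms] by metis

lemma final_blocks_carrier: "block_row k final_blocks \<in> carrier_mat k n"
  unfolding sum_dim_col_final_blocks[symmetric]
  by (rule block_row_carrier) (auto simp: final_blocks_def)

lemma spread_code_subset_grassmannian: "spread_code n h k r p p' \<subseteq> grassmannian k n"
proof
  fix U assume "U \<in> spread_code n h k r p p'"
  then show "U \<in> grassmannian k n"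
  proof (cases rule: spread_code_cases)
    case (1 i A A')
    show ?thesis
      unfolding 1(2)
      by (rule rowsp_block_row_in_grassmannian[OF dim_row_blocks[OF 1(1)] sum_dim_col_blocks[OF 1(1)]])
        (auto simp: blocks_def)
  next
    case 2
    show ?thesis
      unfolding 2 by (rule rowsp_block_row_in_grassmannian[OF _ sum_dim_col_final_blocks])
        (auto simp: final_blocks_def)
  qed
qed

section \<open>Common vectors and intersections of codewords\<close>

lemma blocks_eq_of_common_vector:
  assumes adm: "admissible i A A'" "admissible j B B'"
    and x: "x \<in> carrier_vec k" and y: "y \<in> carrier_vec k"
    and eq: "(block_row k (blocks i A A'))\<^sup>T *\<^sub>v x = (block_row k (blocks j B B'))\<^sup>T *\<^sub>v y"
    and nz: "x \<noteq> 0\<^sub>v k" "y \<noteq> 0\<^sub>v k"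
  shows "blocks i A A' = blocks j B B'"
proof -
  have i: "1 \<le> i" "i < h" and j: "1 \<le> j" "j < h" using adm by auto
  have "list_all2 (\<lambda>B C. B\<^sup>T *\<^sub>v x = C\<^sup>T *\<^sub>v y) (blocks i A A') (blocks j B B')"
    using eq x y
    by (intro block_row_eq_prefixD[of k _ _ "[]" "[]"])
      (auto simp: list_all2_conv_all_nth length_blocks[OF adm(1)] length_blocks[OF adm(2)]
        dim_nth_blocks[OF adm(1)] dim_nth_blocks[OF adm(2)])
  then have blk: "(blocks i A A' ! l)\<^sup>T *\<^sub>v x = (blocks j B B' ! l)\<^sup>T *\<^sub>v y" if "l < h" for l
    using that length_blocks[OF adm(1)] unfolding list_all2_conv_all_nth by metis
  \<comment> \<open>At the earlier of two different pivots one matrix has an identity and the other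
    a zero block, forcing one coefficient vector to vanish.\<close>
  have ij: "i = j"
  proof (cases i j rule: linorder_cases)
    case less
    then have "blocks i A A' ! (i - 1) = 1\<^sub>m k" "blocks j B B' ! (i - 1) = 0\<^sub>m k k"
      using i j by (auto simp: nth_blocks)
    then show ?thesis using blk[of "i - 1"] i(2) nz x y by (simp add: zero_mat_mult_vec less_imp_diff_less)
  next
    case greater
    then have "blocks i A A' ! (j - 1) = 0\<^sub>m k k" "blocks j B B' ! (j - 1) = 1\<^sub>m k"
      using i j by (auto simp: nth_blocks)
    then show ?thesis using blk[of "j - 1"] j(2) nz x y by (simp add: zero_mat_mult_vec less_imp_diff_less)
  qed
  \<comment> \<open>Both matrices now have the identity at the common pivot.\<close>
  have xy: "x = y"
    using blk[of "i - 1"] i x y ij by (simp add: nth_blocks)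
  show ?thesis
  proof (rule nth_equalityI)
    fix l assume "l < length (blocks i A A')"
    then have l: "l < h" using length_blocks[OF adm(1)] by metis
    \<comment> \<open>Up to the pivot the blocks depend on \<open>i\<close> alone; after it come
      blocks from the algebra of \<open>p\<close>, and finally the one from
      \<open>p'\<close>.\<close>
    consider "l \<le> i - 1" | "i \<le> l" "l < h - 1" | "l = h - 1" using l by linarith
    then show "blocks i A A' ! l = blocks j B B' ! l"
    proof cases
      case 1
      then show ?thesis
        unfolding nth_blocks[OF i l] nth_blocks[OF j l] ij by auto
    next
      case 2
      then have at_l: "blocks i A A' ! l = A (Suc l)" "blocks j B B' ! l = B (Suc l)"
        using i ij l by (auto simp: nth_blocks)
      have "A (Suc l) \<in> gen_algebra (companion_mat p)" "B (Suc l) \<in> gen_algebra (companion_mat p)"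
        using adm ij 2 by auto
      moreover have "(A (Suc l))\<^sup>T *\<^sub>v x = (B (Suc l))\<^sup>T *\<^sub>v x"
        using blk[OF l] at_l xy by simp
      ultimately have "A (Suc l) = B (Suc l)"
        using gen_algebra_companion_mat_inject[OF p k _ _ x nz(1)] by blast
      then show ?thesis using at_l by simp
    next
      case 3
      have carr: "A' \<in> carrier_mat (r + k) (r + k)" "B' \<in> carrier_mat (r + k) (r + k)"
        using adm companion_algebra_carrier(2) by (simp_all add: add.commute)
      have at_l: "blocks i A A' ! l = last_rows k A'" "blocks j B B' ! l = last_rows k B'"
        using 3 i ij l by (auto simp: nth_blocks)
      have "(last_rows k A')\<^sup>T *\<^sub>v x = (last_rows k B')\<^sup>T *\<^sub>v x"
        using blk[OF l] at_l xy by simp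
      \<comment> \<open>The algebra of \<open>p'\<close> acts on vectors of length
        \<open>k + r\<close>, so \<open>x\<close> is padded; it stays nonzero, and even the
        untruncated matrices coincide.\<close>
      then have "A'\<^sup>T *\<^sub>v (0\<^sub>v r @\<^sub>v x) = B'\<^sup>T *\<^sub>v (0\<^sub>v r @\<^sub>v x)"
        using transpose_last_rows_mult_vec[OF carr(1) x] transpose_last_rows_mult_vec[OF carr(2) x]
        by simp
      moreover have "0\<^sub>v r @\<^sub>v x \<noteq> 0\<^sub>v (k + r)"
      proof
        assume "0\<^sub>v r @\<^sub>v x = 0\<^sub>v (k + r)"
        moreover have "0\<^sub>v (k + r) = 0\<^sub>v r @\<^sub>v (0\<^sub>v k :: 'a vec)" by auto
        ultimately show False using nz(1) append_vec_eq[of "0\<^sub>v r" r "0\<^sub>v r" x] by simp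
      qed
      moreover have "0\<^sub>v r @\<^sub>v x \<in> carrier_vec (k + r)" using x by (intro carrier_vecI) simp
      ultimately have "A' = B'"
        using adm k by (intro gen_algebra_companion_mat_inject[OF p', of _ _ "0\<^sub>v r @\<^sub>v x"]) auto
      then show ?thesis using at_l by simp
    qed
  qed (simp only: length_blocks[OF adm(1)] length_blocks[OF adm(2)])
qed

text \<open>The pivot position \<open>i - 1\<close> is below \<open>h - 1\<close>, where the final
  matrix has only zero blocks, so the identity block returns \<open>x\<close> as zero.\<close>

lemma blocks_final_blocks_common_vector:
  assumes adm: "admissible i A A'" and x: "x \<in> carrier_vec k" and y: "y \<in> carrier_vec k"
    and eq: "(block_row k (blocks i A A'))\<^sup>T *\<^sub>v x = (block_row k final_blocks)\<^sup>T *\<^sub>v y"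
  shows "x = 0\<^sub>v k"
proof -
  have i: "1 \<le> i" "i < h" using adm by auto
  let ?L = "blocks i A A'"
  have "list_all2 (\<lambda>B C. B\<^sup>T *\<^sub>v x = C\<^sup>T *\<^sub>v y) (take (h - 1) ?L) (replicate (h - 1) (0\<^sub>m k k))"
  proof (rule block_row_eq_prefixD[of k _ _ "drop (h - 1) ?L" "[0\<^sub>m k r, 1\<^sub>m k]"])
    show "list_all2 (\<lambda>B C. dim_row B = k \<and> dim_row C = k \<and> dim_col B = dim_col C)
        (take (h - 1) ?L) (replicate (h - 1) (0\<^sub>m k k))"
      using dim_nth_blocks[OF adm] length_blocks[OF adm]
      by (simp add: list_all2_conv_all_nth)
    show "dim_row B = k" if "B \<in> set (drop (h - 1) ?L)" for B
      using dim_row_blocks[OF adm] in_set_dropD[OF that] by blast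
    show "(block_row k (take (h - 1) ?L @ drop (h - 1) ?L))\<^sup>T *\<^sub>v x
        = (block_row k (replicate (h - 1) (0\<^sub>m k k) @ [0\<^sub>m k r, 1\<^sub>m k]))\<^sup>T *\<^sub>v y"
      using eq unfolding append_take_drop_id final_blocks_def .
  qed (use x y in auto)
  then have "(?L ! (i - 1))\<^sup>T *\<^sub>v x = (0\<^sub>m k k)\<^sup>T *\<^sub>v y"
    using i unfolding list_all2_conv_all_nth by fastforce
  then show ?thesis using i x y by (simp add: nth_blocks zero_mat_mult_vec)
qed

lemma rowsp_blocks_inter:
  assumes adm: "admissible i A A'" "admissible j B B'"
    and ne: "rowsp n (block_row k (blocks i A A')) \<noteq> rowsp n (block_row k (blocks j B B'))"
    and v: "v \<in> rowsp n (block_row k (blocks i A A'))" "v \<in> rowsp n (block_row k (blocks j B B'))"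
  shows "v = 0\<^sub>v n"
proof (rule ccontr)
  assume v0: "v \<noteq> 0\<^sub>v n"
  obtain x y where x: "x \<in> carrier_vec k" "v = (block_row k (blocks i A A'))\<^sup>T *\<^sub>v x"
    and y: "y \<in> carrier_vec k" "v = (block_row k (blocks j B B'))\<^sup>T *\<^sub>v y"
    using v unfolding mem_rowsp_iff[OF blocks_carrier[OF adm(1)]]
      mem_rowsp_iff[OF blocks_carrier[OF adm(2)]] by blast
  \<comment> \<open>The zero coefficient vector yields the zero codeword vector, so a nonzero
    \<open>v\<close> has nonzero \<open>x\<close> and \<open>y\<close>.\<close>
  have "M\<^sup>T *\<^sub>v 0\<^sub>v k = 0\<^sub>v n" if "M \<in> carrier_mat k n" for M :: "'a mat"
    using that by (intro eq_vecI) auto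
  then have "x \<noteq> 0\<^sub>v k" "y \<noteq> 0\<^sub>v k"
    using v0 x y blocks_carrier[OF adm(1)] blocks_carrier[OF adm(2)] by metis+
  then have "blocks i A A' = blocks j B B'"
    using blocks_eq_of_common_vector[OF adm x(1) y(1)] x(2) y(2) by metis
  then show False using ne by metis
qed

lemma rowsp_blocks_final_blocks_inter:
  assumes adm: "admissible i A A'" and v: "v \<in> rowsp n (block_row k (blocks i A A'))"
    "v \<in> rowsp n (block_row k final_blocks)"
  shows "v = 0\<^sub>v n"
proof -
  obtain x y where x: "x \<in> carrier_vec k" "v = (block_row k (blocks i A A'))\<^sup>T *\<^sub>v x"
    and y: "y \<in> carrier_vec k" "v = (block_row k final_blocks)\<^sup>T *\<^sub>v y"
    using v unfolding mem_rowsp_iff[OF blocks_carrier[OF adm]]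
      mem_rowsp_iff[OF final_blocks_carrier] by blast
  have "x = 0\<^sub>v k"
    using blocks_final_blocks_common_vector[OF adm x(1) y(1)] x(2) y(2) by metis
  then show ?thesis
    unfolding x(2) using blocks_carrier[OF adm] by (intro eq_vecI) auto
qed

lemma spread_code_inter:
  assumes "U \<in> spread_code n h k r p p'" "V \<in> spread_code n h k r p p'" "U \<noteq> V"
  shows "U \<inter> V = {0\<^sub>v n}"
proof -
  have "v = 0\<^sub>v n" if v: "v \<in> U" "v \<in> V" for v
    using assms(1)
  proof (cases rule: spread_code_cases)
    case (1 i A A')
    note U = this
    show ?thesis
      using assms(2)
    proof (cases rule: spread_code_cases)
      case (1 j B B')
      note V = this
      show ?thesis
        using rowsp_blocks_inter[OF U(1) V(1)] v assms(3) unfolding U(2) V(2) by blast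
    next
      case 2
      show ?thesis
        using rowsp_blocks_final_blocks_inter[OF U(1)] v unfolding U(2) 2 by blast
    qed
  next
    case 2
    note U = this
    show ?thesis
      using assms(2)
    proof (cases rule: spread_code_cases)
      case (1 j B B')
      show ?thesis
        using rowsp_blocks_final_blocks_inter[OF 1(1)] v unfolding U 1(2) by blast
    next
      case 2
      then show ?thesis using U assms(3) by blast
    qed
  qed
  \<comment> \<open>The other inclusion: a subspace contains the zero vector.\<close>
  then show ?thesis
    using zero_in_grassmannian spread_code_subset_grassmannian assms(1,2) by blast
qed

lemma spread_code_two_members: "\<exists>U\<in>spread_code n h k r p p'. \<exists>V\<in>spread_code n h k r p p'. U \<noteq> V"
proof -
  \<comment> \<open>The pivot index 1 is allowed because \<open>h \<ge> 2\<close>; the generators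
    themselves serve as algebra elements.\<close>
  define M where "M = block_row k (blocks 1 (\<lambda>_. companion_mat p) (companion_mat p'))"
  have adm: "admissible 1 (\<lambda>_. companion_mat p) (companion_mat p')"
    using h by (auto intro: gen_algebra.gen)
  have mem: "rowsp n M \<in> spread_code n h k r p p'"
    using adm unfolding M_def blocks_def spread_code_def code_matrices_def by blast
  have mem': "rowsp n (block_row k final_blocks) \<in> spread_code n h k r p p'"
    unfolding spread_code_def final_blocks_def by blast
  \<comment> \<open>If the two codewords coincided, their trivial intersection would make
    \<open>M\<close> span only the zero space, against dimension \<open>k \<ge> 1\<close>.\<close>
  have "rowsp n M \<noteq> rowsp n (block_row k final_blocks)"
  proof
    assume "rowsp n M = rowsp n (block_row k final_blocks)"
    then have "rowsp n M \<subseteq> {0\<^sub>v n}"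
      using rowsp_blocks_final_blocks_inter[OF adm] unfolding M_def by blast
    moreover have "rowsp n M \<in> grassmannian k n"
      using mem spread_code_subset_grassmannian by blast
    ultimately have "{0\<^sub>v n :: 'a vec} \<in> grassmannian k n"
      using zero_in_grassmannian by (metis subset_singletonD empty_iff)
    then show False using k by (auto simp: grassmannian_def sdim_zero)
  qed
  then show ?thesis using mem mem' by blast
qed

lemma partial_spread_code_spread_code: "partial_spread_code k n (spread_code n h k r p p')"
  unfolding partial_spread_code_def partial_spread_def
  using spread_code_subset_grassmannian spread_code_inter spread_code_two_members by blast

end

theorem theorem13:
  fixes p p' :: "'a::{field,finite} poly"
    and n k h r :: nat
  assumes "1 \<le> k" and "k < n"
    and "n = h * k + r" and "r \<le> k - 1"
    and "h \<ge> 2"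
    and "irreducible p" and "lead_coeff p = 1" and "degree p = k"
    and "irreducible p'" and "lead_coeff p' = 1" and "degree p' = k + r"
  shows "partial_spread_code k n (spread_code n h k r p p') \<and>
    min_dist n (spread_code n h k r p p') = 2 * int k"
  using partial_spread_code_spread_code[OF assms(1,3,5-11)] partial_spread_code_min_dist by blast

end
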